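(* Let $(X,\mathcal{A},d)$ be a complete $C^*$-algebra-valued metric space. Suppose that the mappings $F\colon X\times X\rightarrow X$ and $g\colon X\rightarrow X$ satisfy $$d(F(x,y),F(u,v))\preceq a^*d(gx,gu)a+a^*d(gy,gv)a \quad\text{for any } x,y,u,v\in X,$$ where $a\in\mathcal{A}$ with $\|a\|<\frac{1}{\sqrt{2}}$. If $F(X\times X)\subseteq g(X)$ and $g(X)$ is complete in $X$, then $F$ and $g$ have a coupled coincidence point. Moreover, if $F$ and $g$ are w-compatible, then they have a unique common coupled fixed point in $X$.
   Context: $\mathcal{A}$ is a unital (complex) $C^*$-algebra with zero element $0_{\mathcal A}$ and unit $1_{\mathcal A}$. An element $a\in\mathcal A$ is positive, written $0_{\mathcal A}\preceq a$, if $a$ is hermitian and its spectrum is contained in $[0,+\infty)$; for hermitian $a,b$, $a\preceq b$ means $0_{\mathcal A}\preceq b-a$. A $C^*$-algebra-valued metric space $(X,\mathcal A,d)$ consists of a nonempty set $X$ and a map $d\colon X\times X\to\mathcal A$ such that for all $x,y,z\in X$: (1) $0_{\mathcal A}\preceq d(x,y)$; (2) $d(x,y)=0_{\mathcal A}$ iff $x=y$; (3) $d(x,y)=d(y,x)$; (4) $d(x,y)\preceq d(x,z)+d(z,y)$. A sequence $\{x_n\}$ converges to $x$ if $\|d(x_n,x)\|\to 0$; it is Cauchy if $\|d(x_{n+p},x_n)\|\to 0$ as $n\to\infty$, uniformly in $p\in\mathbb N$. The space is complete if every Cauchy sequence in $X$ converges in $X$; a subset $g(X)$ is complete if every Cauchy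 sequence in $g(X)$ converges to a point of $g(X)$. We write $gx=g(x)$. For $F\colon X\times X\to X$ and $g\colon X\to X$, a pair $(x,y)\in X\times X$ is a coupled coincidence point of $F$ and $g$ if $F(x,y)=gx$ and $F(y,x)=gy$; it is a common coupled fixed point of $F$ and $g$ if $F(x,y)=gx=x$ and $F(y,x)=gy=y$. $F$ and $g$ are w-compatible if $g(F(x,y))=F(gx,gy)$ whenever $gx=F(x,y)$ and $gy=F(y,x)$. *)

theory Defs
  imports "HOL-Analysis.Analysis"
begin

text \<open>
  Unital complex C*-algebras. The unit is taken from \<^class>\<open>monoid_mult\<close> and not from
  \<^class>\<open>real_normed_algebra_1\<close>, which would exclude the zero algebra by demanding
  \<open>0 \<noteq> 1\<close> and \<open>norm 1 = 1\<close>.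
\<close>

class unital_cstar_algebra = real_normed_algebra + banach + monoid_mult +
  fixes scaleC :: "complex \<Rightarrow> 'a \<Rightarrow> 'a"  (infixr "*\<^sub>C" 75)
    and cstar :: "'a \<Rightarrow> 'a"
  assumes scaleC_add_right: "c *\<^sub>C (x + y) = c *\<^sub>C x + c *\<^sub>C y"
    and scaleC_add_left: "(b + c) *\<^sub>C x = b *\<^sub>C x + c *\<^sub>C x"
    and scaleC_scaleC: "b *\<^sub>C c *\<^sub>C x = (b * c) *\<^sub>C x"
    and scaleC_of_real: "complex_of_real r *\<^sub>C x = r *\<^sub>R x"
    and mult_scaleC_left: "(c *\<^sub>C x) * y = c *\<^sub>C (x * y)"
    and mult_scaleC_right: "x * (c *\<^sub>C y) = c *\<^sub>C (x * y)"
    and norm_scaleC: "norm (c *\<^sub>C x) = cmod c * norm x"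
    and cstar_cstar: "cstar (cstar x) = x"
    and cstar_add: "cstar (x + y) = cstar x + cstar y"
    and cstar_scaleC: "cstar (c *\<^sub>C x) = cnj c *\<^sub>C cstar x"
    and cstar_mult: "cstar (x * y) = cstar y * cstar x"
    and cstar_identity: "norm (cstar x * x) = (norm x)\<^sup>2"

definition hermitian :: "'a::unital_cstar_algebra \<Rightarrow> bool"
  where "hermitian a \<longleftrightarrow> cstar a = a"

definition spectrum :: "'a::unital_cstar_algebra \<Rightarrow> complex set"
  where "spectrum a =
    {z. \<not> (\<exists>b. (z *\<^sub>C 1 - a) * b = 1 \<and> b * (z *\<^sub>C 1 - a) = 1)}"

definition cstar_positive :: "'a::unital_cstar_algebra \<Rightarrow> bool"
  where "cstar_positive a \<longleftrightarrow> hermitian a \<and> spectrum a \<subseteq> complex_of_real ` {0..}"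

definition cstar_le :: "'a::unital_cstar_algebra \<Rightarrow> 'a \<Rightarrow> bool"  (infix "\<preceq>" 50)
  where "a \<preceq> b \<longleftrightarrow> hermitian a \<and> hermitian b \<and> cstar_positive (b - a)"

locale cstar_metric_space =
  fixes X :: "'x set"
    and d :: "'x \<Rightarrow> 'x \<Rightarrow> 'a::unital_cstar_algebra"
  assumes nonempty: "X \<noteq> {}"
    and positive: "\<lbrakk>x \<in> X; y \<in> X\<rbrakk> \<Longrightarrow> cstar_positive (d x y)"
    and zero_iff: "\<lbrakk>x \<in> X; y \<in> X\<rbrakk> \<Longrightarrow> d x y = 0 \<longleftrightarrow> x = y"
    and commute: "\<lbrakk>x \<in> X; y \<in> X\<rbrakk> \<Longrightarrow> d x y = d y x"
    and triangle: "\<lbrakk>x \<in> X; y \<in> X; z \<in> X\<rbrakk> \<Longrightarrow> d x y \<preceq> d x z + d z y"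

definition cstar_converges_to ::
    "('x \<Rightarrow> 'x \<Rightarrow> 'a::unital_cstar_algebra) \<Rightarrow> (nat \<Rightarrow> 'x) \<Rightarrow> 'x \<Rightarrow> bool"
  where "cstar_converges_to d s l \<longleftrightarrow> (\<lambda>n. norm (d (s n) l)) \<longlonglongrightarrow> 0"

definition cstar_Cauchy ::
    "('x \<Rightarrow> 'x \<Rightarrow> 'a::unital_cstar_algebra) \<Rightarrow> (nat \<Rightarrow> 'x) \<Rightarrow> bool"
  where "cstar_Cauchy d s \<longleftrightarrow>
    uniform_limit UNIV (\<lambda>n p. norm (d (s (n + p)) (s n))) (\<lambda>p. 0) sequentially"

definition cstar_complete ::
    "('x \<Rightarrow> 'x \<Rightarrow> 'a::unital_cstar_algebra) \<Rightarrow> 'x set \<Rightarrow> bool"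
  where "cstar_complete d S \<longleftrightarrow>
    (\<forall>s. range s \<subseteq> S \<and> cstar_Cauchy d s \<longrightarrow> (\<exists>l\<in>S. cstar_converges_to d s l))"

definition coupled_coincidence_point ::
    "'x set \<Rightarrow> ('x \<times> 'x \<Rightarrow> 'x) \<Rightarrow> ('x \<Rightarrow> 'x) \<Rightarrow> 'x \<times> 'x \<Rightarrow> bool"
  where "coupled_coincidence_point X F g p \<longleftrightarrow>
    (case p of (x, y) \<Rightarrow> x \<in> X \<and> y \<in> X \<and> F (x, y) = g x \<and> F (y, x) = g y)"

definition common_coupled_fixed_point ::
    "'x set \<Rightarrow> ('x \<times> 'x \<Rightarrow> 'x) \<Rightarrow> ('x \<Rightarrow> 'x) \<Rightarrow> 'x \<times> 'x \<Rightarrow> bool"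
  where "common_coupled_fixed_point X F g p \<longleftrightarrow>
    (case p of (x, y) \<Rightarrow>
      x \<in> X \<and> y \<in> X \<and> F (x, y) = g x \<and> g x = x \<and> F (y, x) = g y \<and> g y = y)"

definition w_compatible ::
    "'x set \<Rightarrow> ('x \<times> 'x \<Rightarrow> 'x) \<Rightarrow> ('x \<Rightarrow> 'x) \<Rightarrow> bool"
  where "w_compatible X F g \<longleftrightarrow>
    (\<forall>x\<in>X. \<forall>y\<in>X. g x = F (x, y) \<and> g y = F (y, x) \<longrightarrow> g (F (x, y)) = F (g x, g y))"

end

theory Submission
  imports Defs
begin

text \<open>
  The whole analytic content is that the norm is monotone on positive elements: then
  \<open>norm (d x y)\<close> is an ordinary metric, for which \<open>(gx, gy) \<mapsto> (F(x, y), F(y, x))\<close> is a contraction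
  of the sum metric on \<open>g(X) \<times> g(X)\<close> with constant \<open>2 \<parallel>a\<parallel>\<^sup>2 < 1\<close>, and Banach's theorem applies.

  Monotonicity needs that a nonzero hermitian \<open>h\<close> has a spectral value of modulus \<open>\<parallel>h\<parallel>\<close>. Scale
  to \<open>\<parallel>h\<parallel> = 1\<close> and suppose that \<open>1 - \<mu>h\<close> is invertible for all \<open>\<mu>\<close> on the unit circle. The
  inverses are bounded by compactness, hence for \<open>t < 1\<close> close to 1 they are uniformly
  \<open>\<epsilon>\<close>-close to those of \<open>1 - \<mu>th\<close>. The inverse of \<open>1 - \<mu>\<^sup>2h\<^sup>2\<close> is the mean of the inverses of
  \<open>1 - \<mu>h\<close> and \<open>1 + \<mu>h\<close>, so \<open>\<epsilon>\<close>-closeness survives repeated squaring of \<open>h\<close> and \<open>th\<close>. But the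
  powers of \<open>th\<close> tend to 0, while repeated squares of \<open>h\<close> keep norm 1.
\<close>

section \<open>Basic facts on C*-algebras\<close>

lemma scaleC_zero_left [simp]: "0 *\<^sub>C (x :: 'a::unital_cstar_algebra) = 0"
  using scaleC_of_real[of 0 x] by simp

lemma scaleC_one [simp]: "1 *\<^sub>C (x :: 'a::unital_cstar_algebra) = x"
  using scaleC_of_real[of 1 x] by simp

lemma scaleC_zero_right [simp]: "c *\<^sub>C 0 = 0"
  using scaleC_add_right[of c 0 0] by simp

lemma scaleC_minus_right [simp]: "c *\<^sub>C (- x) = - (c *\<^sub>C x)"
  using scaleC_add_right[of c x "- x"] by (simp add: eq_neg_iff_add_eq_0 add.commute)

lemma scaleC_minus_left [simp]: "(- c) *\<^sub>C x = - (c *\<^sub>C x)"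
  using scaleC_add_left[of c "- c" x] by (simp add: eq_neg_iff_add_eq_0 add.commute)

lemma scaleC_diff_right: "c *\<^sub>C (x - y) = c *\<^sub>C x - c *\<^sub>C y"
  using scaleC_add_right[of c x "- y"] by simp

lemma scaleC_diff_left: "(b - c) *\<^sub>C x = b *\<^sub>C x - c *\<^sub>C x"
  using scaleC_add_left[of b "- c" x] by simp

lemma cstar_zero [simp]: "cstar 0 = 0"
  using cstar_add[of 0 0] by simp

lemma cstar_minus [simp]: "cstar (- x) = - cstar x"
  using cstar_add[of x "- x"] by (simp add: eq_neg_iff_add_eq_0 add.commute)

lemma cstar_diff: "cstar (x - y) = cstar x - cstar y"
  using cstar_add[of x "- y"] by simp

lemma cstar_one [simp]: "cstar 1 = 1"
  by (metis cstar_cstar cstar_mult mult_1_left mult_1_right)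

text \<open>The C*-identity gives \<open>(norm y)^2 <= norm (cstar y) * norm y\<close>; cancelling
  \<open>norm y\<close> yields one inequality, and applying it to \<open>cstar x\<close> the
  other.\<close>

lemma norm_cstar [simp]: "norm (cstar (x :: 'a::unital_cstar_algebra)) = norm x"
proof -
  have le: "norm y \<le> norm (cstar y)" for y :: 'a
  proof (cases "y = 0")
    case False
    have "norm y * norm y \<le> norm (cstar y) * norm y"
      using cstar_identity[of y] norm_mult_ineq[of "cstar y" y] by (simp add: power2_eq_square)
    with False show ?thesis by simp
  qed simp
  show ?thesis
    using le[of x] le[of "cstar x"] by (simp add: cstar_cstar)
qed

text \<open>By the C*-identity \<open>norm 1\<close> equals its own square, so it is 0 or 1; the
  value 0 occurs in the zero algebra.\<close>

lemma norm_one_le: "norm (1 :: 'a::unital_cstar_algebra) \<le> 1"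
proof -
  have "norm (1::'a) = norm (1::'a) * norm (1::'a)"
    using cstar_identity[of "1::'a"] by (simp add: power2_eq_square)
  then show ?thesis by (metis mult_cancel_left1 order_refl zero_le_one norm_zero)
qed

lemma hermitian_scaled_one: "hermitian (complex_of_real r *\<^sub>C 1)"
  by (simp add: hermitian_def cstar_scaleC)

lemma hermitian_diff: "hermitian x \<Longrightarrow> hermitian y \<Longrightarrow> hermitian (x - y)"
  by (simp add: hermitian_def cstar_diff)

lemma norm_hermitian_square:
  fixes h :: "'a::unital_cstar_algebra"
  assumes "hermitian h"
  shows "norm (h * h) = (norm h)\<^sup>2"
  using cstar_identity[of h] assms by (simp add: hermitian_def)

definition inverses :: "'a::monoid_mult \<Rightarrow> 'a \<Rightarrow> bool"
  where "inverses u v \<longleftrightarrow> u * v = 1 \<and> v * u = 1"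

text \<open>The second resolvent identity. All perturbation estimates for inverses below come from
  it.\<close>

lemma inverses_diff:
  fixes u :: "'a::{ring, monoid_mult}"
  assumes "inverses u v" "inverses u' v'"
  shows "v - v' = v * (u' - u) * v'"
proof -
  have "v * (u' - u) * v' = v * (u' * v') - (v * u) * v'"
    by (simp add: algebra_simps)
  with assms show ?thesis by (simp add: inverses_def)
qed

lemma inverses_scaleC:
  fixes u :: "'a::unital_cstar_algebra"
  assumes "inverses u v" "c \<noteq> 0"
  shows "inverses (c *\<^sub>C u) (inverse c *\<^sub>C v)"
  using assms by (simp add: inverses_def mult_scaleC_left mult_scaleC_right scaleC_scaleC)

lemma spectrum_iff: "z \<in> spectrum a \<longleftrightarrow> \<not> (\<exists>b. inverses (z *\<^sub>C 1 - a) b)"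
  by (simp add: spectrum_def inverses_def)

text \<open>The Neumann series, as the fixed point of \<open>y \<mapsto> 1 + x y\<close>.\<close>

lemma inverses_one_minus:
  fixes x :: "'a::unital_cstar_algebra"
  assumes "norm x < 1"
  obtains v where "inverses (1 - x) v"
proof -
  have "\<exists>!y. 1 + x * y = y"
    by (rule banach_fix_type[of "norm x"])
      (auto simp: assms dist_norm norm_mult_ineq simp flip: right_diff_distrib)
  then obtain y where y: "1 + x * y = y" by blast
  \<comment> \<open>The first fixed point is only a right inverse of \<open>1 - x\<close>. The
    mirrored equation supplies a left inverse, and associativity makes the two equal.\<close>
  have "\<exists>!y. 1 + y * x = y"
    by (rule banach_fix_type[of "norm x"])
      (auto simp: assms dist_norm mult.commute[of "norm x"] norm_mult_ineq simp flip: left_diff_distrib)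
  then obtain z where z: "1 + z * x = z" by blast
  have yz: "(1 - x) * y = 1" "z * (1 - x) = 1"
    using y z by (simp_all add: left_diff_distrib right_diff_distrib diff_eq_eq)
  then have "z = y"
    by (metis mult.assoc mult_1_left mult_1_right)
  with yz that show thesis by (simp add: inverses_def)
qed

text \<open>If \<open>cmod z > norm h\<close>, then \<open>z - h = z (1 - h/z)\<close> is invertible
  by the Neumann series.\<close>

lemma cmod_spectrum_le:
  assumes "z \<in> spectrum h"
  shows "cmod z \<le> norm h"
proof (rule ccontr)
  assume *: "\<not> cmod z \<le> norm h"
  then have z: "z \<noteq> 0" by auto
  have "norm (inverse z *\<^sub>C h) < 1"
    using * z by (simp add: norm_scaleC norm_inverse norm_divide divide_simps mult.commute)
  then obtain v where "inverses (1 - inverse z *\<^sub>C h) v"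
    by (rule inverses_one_minus)
  from inverses_scaleC[OF this z] have "inverses (z *\<^sub>C 1 - h) (inverse z *\<^sub>C v)"
    using z by (simp add: scaleC_diff_right scaleC_scaleC)
  with assms show False by (auto simp: spectrum_iff)
qed

text \<open>The elements \<open>z - (c - h)\<close> and \<open>(c - z) - h\<close> differ only by
  the factor -1.\<close>

lemma spectrum_scaled_one_minus:
  assumes "z \<in> spectrum (c *\<^sub>C 1 - h)"
  shows "c - z \<in> spectrum h"
proof (rule ccontr)
  assume "c - z \<notin> spectrum h"
  then obtain b where "inverses ((c - z) *\<^sub>C 1 - h) b"
    by (auto simp: spectrum_iff)
  from inverses_scaleC[OF this, of "-1"]
  have "inverses (z *\<^sub>C 1 - (c *\<^sub>C 1 - h)) (inverse (-1) *\<^sub>C b)"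
    by (simp add: scaleC_diff_left scaleC_diff_right algebra_simps)
  with assms show False by (auto simp: spectrum_iff)
qed

section \<open>A spectral value on the norm circle\<close>

text \<open>Invertibility on the whole unit circle is part of the relation, so that squaring
  transports it together with the bound.\<close>

definition resolvents_near ::
    "real \<Rightarrow> 'a::unital_cstar_algebra \<Rightarrow> 'a \<Rightarrow> bool"
  where "resolvents_near e h k \<longleftrightarrow>
    (\<forall>\<mu>. cmod \<mu> = 1 \<longrightarrow> (\<exists>R S. inverses (1 - \<mu> *\<^sub>C h) R \<and> inverses (1 - \<mu> *\<^sub>C k) S \<and> norm (R - S) \<le> e))"

text \<open>Partial fractions: \<open>(1 - h * h) * R = 1 + h\<close> and
  \<open>(1 - h * h) * R' = 1 - h\<close> add up to 2, and likewise on the other side.\<close>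

lemma inverses_square:
  fixes h :: "'a::unital_cstar_algebra"
  assumes "inverses (1 - h) R" "inverses (1 - (- h)) R'"
  shows "inverses (1 - h * h) ((1/2) *\<^sub>R (R + R'))"
proof -
  have f: "1 - h * h = (1 - h) * (1 + h)" "1 - h * h = (1 + h) * (1 - h)"
    by (simp_all add: algebra_simps)
  have "(1 - h * h) * R = 1 + h"
    using assms(1) unfolding f(2) inverses_def by (simp add: mult.assoc)
  moreover have "(1 - h * h) * R' = 1 - h"
    using assms(2) unfolding f(1) inverses_def by (simp add: mult.assoc)
  moreover have "R * (1 - h * h) = 1 + h"
    using assms(1) unfolding f(1) inverses_def by (metis mult.assoc mult_1_left)
  moreover have "R' * (1 - h * h) = 1 - h"
    using assms(2) unfolding f(2) inverses_def by (metis mult.assoc mult_1_left diff_minus_eq_add)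
  ultimately show ?thesis
    by (simp add: inverses_def distrib_left distrib_right flip: scaleR_2)
qed

text \<open>Both square roots of a point of the unit circle lie on the circle, and the mean of two
  differences of norm at most \<open>e\<close> again has norm at most \<open>e\<close>.\<close>

lemma resolvents_near_square:
  fixes h :: "'a::unital_cstar_algebra"
  assumes "resolvents_near e h k"
  shows "resolvents_near e (h * h) (k * k)"
  unfolding resolvents_near_def
proof (intro allI impI)
  fix \<mu> :: complex
  assume "cmod \<mu> = 1"
  define \<nu> where "\<nu> = csqrt \<mu>"
  have \<nu>: "cmod \<nu> = 1" "cmod (- \<nu>) = 1" "\<nu> * \<nu> = \<mu>"
    using \<open>cmod \<mu> = 1\<close> by (simp_all add: \<nu>_def flip: power2_eq_square)
  obtain R S where RS: "inverses (1 - \<nu> *\<^sub>C h) R" "inverses (1 - \<nu> *\<^sub>C k) S" "norm (R - S) \<le> e"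
    using assms \<nu>(1) unfolding resolvents_near_def by blast
  obtain R' S' where RS': "inverses (1 - (- \<nu>) *\<^sub>C h) R'" "inverses (1 - (- \<nu>) *\<^sub>C k) S'"
      "norm (R' - S') \<le> e"
    using assms \<nu>(2) unfolding resolvents_near_def by blast
  have sq: "\<mu> *\<^sub>C (x * x) = (\<nu> *\<^sub>C x) * (\<nu> *\<^sub>C x)" for x :: 'a
    by (simp add: mult_scaleC_left mult_scaleC_right scaleC_scaleC \<nu>(3))
  have "norm ((R - S) + (R' - S')) \<le> 2 * e"
    using norm_triangle_ineq[of "R - S" "R' - S'"] RS RS' by linarith
  moreover have "(1/2) *\<^sub>R (R + R') - (1/2) *\<^sub>R (S + S') = (1/2) *\<^sub>R ((R - S) + (R' - S'))"
    by (simp add: algebra_simps)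
  ultimately have "norm ((1/2) *\<^sub>R (R + R') - (1/2) *\<^sub>R (S + S')) \<le> e"
    by simp
  then show "\<exists>R S. inverses (1 - \<mu> *\<^sub>C (h * h)) R \<and> inverses (1 - \<mu> *\<^sub>C (k * k)) S \<and> norm (R - S) \<le> e"
    unfolding sq using RS RS' inverses_square[of "\<nu> *\<^sub>C h" R R'] inverses_square[of "\<nu> *\<^sub>C k" S S']
    by (metis scaleC_minus_left)
qed

text \<open>The resolvent identity bounds \<open>norm (v - v')\<close> by half of
  \<open>norm v'\<close>, which the triangle inequality then absorbs.\<close>

lemma norm_inverse_le_near:
  fixes u :: "'a::unital_cstar_algebra"
  assumes "inverses u v" "inverses u' v'" "norm (u' - u) * norm v \<le> 1/2"
  shows "norm v' \<le> 2 * norm v"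
proof -
  have "norm (v - v') \<le> norm v * norm (u' - u) * norm v'"
    unfolding inverses_diff[OF assms(1,2)]
    by (meson mult_right_mono norm_ge_zero norm_mult_ineq order_trans)
  also have "\<dots> \<le> 1/2 * norm v'"
    using assms(3) by (intro mult_right_mono) (simp_all add: mult.commute)
  finally show ?thesis
    using norm_triangle_ineq2[of v' v] by (simp add: norm_minus_commute)
qed

text \<open>Around each point of the circle there is a ball on which the norm of the resolvent at
  most doubles; finitely many such balls cover the circle.\<close>

lemma resolvent_bounded_on_circle:
  fixes h :: "'a::unital_cstar_algebra"
  assumes inv: "\<And>\<mu>. cmod \<mu> = 1 \<Longrightarrow> inverses (1 - \<mu> *\<^sub>C h) (R \<mu>)"
  obtains K where "K > 0" "\<And>\<mu>. cmod \<mu> = 1 \<Longrightarrow> norm (R \<mu>) \<le> K"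
proof -
  \<comment> \<open>The 2 produces the bound 1/2 required by \<open>norm_inverse_le_near\<close>;
    the 1 keeps the denominator positive when \<open>h\<close> or \<open>R \<mu>\<close>
    vanishes.\<close>
  define r where "r \<mu> = 1 / (2 * (norm h * norm (R \<mu>) + 1))" for \<mu>
  have r: "r \<mu> > 0" for \<mu>
    unfolding r_def by (simp add: add_nonneg_pos)
  have near: "norm (R \<nu>) \<le> 2 * norm (R \<mu>)"
    if "cmod \<mu> = 1" "cmod \<nu> = 1" "\<nu> \<in> ball \<mu> (r \<mu>)" for \<mu> \<nu>
  proof (rule norm_inverse_le_near[OF inv[OF that(1)] inv[OF that(2)]])
    have "norm ((1 - \<nu> *\<^sub>C h) - (1 - \<mu> *\<^sub>C h)) = cmod (\<mu> - \<nu>) * norm h"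
      by (simp flip: scaleC_diff_left norm_scaleC)
    also have "\<dots> * norm (R \<mu>) \<le> r \<mu> * (norm h * norm (R \<mu>))"
      using that(3) by (simp add: dist_norm mult.assoc mult_right_mono)
    also have "\<dots> \<le> 1/2"
      by (simp add: r_def divide_simps add_nonneg_pos add_nonneg_eq_0_iff)
    finally show "norm ((1 - \<nu> *\<^sub>C h) - (1 - \<mu> *\<^sub>C h)) * norm (R \<mu>) \<le> 1/2" .
  qed
  have "sphere (0::complex) 1 \<subseteq> (\<Union>\<mu>\<in>sphere 0 1. ball \<mu> (r \<mu>))"
    using r by fastforce
  then obtain C where C: "C \<subseteq> sphere 0 1" "finite C" "sphere 0 1 \<subseteq> (\<Union>\<mu>\<in>C. ball \<mu> (r \<mu>))"
    using compactE_image[OF compact_sphere[of "0::complex" 1], of "sphere 0 1" "\<lambda>\<mu>. ball \<mu> (r \<mu>)"]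
    by blast
  show thesis
  proof
    show "(\<Sum>\<mu>\<in>C. 2 * norm (R \<mu>)) + 1 > 0"
      by (simp add: sum_nonneg add_nonneg_pos)
    fix \<nu> :: complex
    assume \<nu>: "cmod \<nu> = 1"
    then obtain \<mu> where \<mu>: "\<mu> \<in> C" "\<nu> \<in> ball \<mu> (r \<mu>)"
      using C(3) by fastforce
    with C(1) have "norm (R \<nu>) \<le> 2 * norm (R \<mu>)"
      by (intro near \<nu>) auto
    also have "\<dots> \<le> (\<Sum>\<mu>\<in>C. 2 * norm (R \<mu>))"
      using \<mu>(1) C(2) by (intro member_le_sum) auto
    finally show "norm (R \<nu>) \<le> (\<Sum>\<mu>\<in>C. 2 * norm (R \<mu>)) + 1" by simp
  qed
qed

text \<open>The resolvents of \<open>t h\<close> exist by the Neumann series. With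
  \<open>t = 1 - s\<close> and \<open>K\<close> bounding the resolvents of \<open>h\<close>, those
  of \<open>t h\<close> are bounded by \<open>2 K\<close>, so the resolvent identity gives a
  distance of at most \<open>2 K K s\<close>.\<close>

lemma resolvents_near_shrink:
  fixes h :: "'a::unital_cstar_algebra"
  assumes inv: "\<And>\<mu>. cmod \<mu> = 1 \<Longrightarrow> \<exists>b. inverses (1 - \<mu> *\<^sub>C h) b"
    and h: "norm h = 1" and e: "e > 0"
  obtains t where "0 < t" "t < 1" "resolvents_near e h (t *\<^sub>R h)"
proof -
  obtain R where R: "\<And>\<mu>. cmod \<mu> = 1 \<Longrightarrow> inverses (1 - \<mu> *\<^sub>C h) (R \<mu>)"
    using inv by metis
  obtain K where K: "K > 0" "\<And>\<mu>. cmod \<mu> = 1 \<Longrightarrow> norm (R \<mu>) \<le> K"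
    using resolvent_bounded_on_circle[of h R] R by blast
  \<comment> \<open>The three bounds serve in turn \<open>t > 0\<close>, the hypothesis of
    \<open>norm_inverse_le_near\<close>, and the final estimate by \<open>e\<close>.\<close>
  define s where "s = min (1/2) (min (1 / (2 * K)) (e / (2 * K * K)))"
  have s: "0 < s" "s < 1"
    using K(1) e by (auto simp: s_def)
  have "s \<le> 1 / (2 * K)" "s \<le> e / (2 * K * K)"
    by (simp_all add: s_def)
  then have sK: "s * K \<le> 1/2" "2 * K * K * s \<le> e"
    using K(1) by (simp_all add: field_simps)
  show thesis
  proof
    show "0 < 1 - s" "1 - s < 1" using s by auto
    show "resolvents_near e h ((1 - s) *\<^sub>R h)"
      unfolding resolvents_near_def
    proof (intro allI impI)
      fix \<mu> :: complex
      assume \<mu>: "cmod \<mu> = 1"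
      have "norm (\<mu> *\<^sub>C ((1 - s) *\<^sub>R h)) < 1"
        using s \<mu> h by (simp add: norm_scaleC)
      then obtain S where S: "inverses (1 - \<mu> *\<^sub>C ((1 - s) *\<^sub>R h)) S"
        by (rule inverses_one_minus)
      have "(1 - \<mu> *\<^sub>C ((1 - s) *\<^sub>R h)) - (1 - \<mu> *\<^sub>C h) = \<mu> *\<^sub>C (s *\<^sub>R h)"
        by (simp flip: scaleC_diff_right add: algebra_simps)
      then have d: "norm ((1 - \<mu> *\<^sub>C ((1 - s) *\<^sub>R h)) - (1 - \<mu> *\<^sub>C h)) = s"
        using \<mu> h s by (simp add: norm_scaleC)
      have R\<mu>: "norm (R \<mu>) \<le> K" using K \<mu> by blast
      have "s * norm (R \<mu>) \<le> 1/2"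
        using s(1) sK(1) R\<mu> by (meson mult_left_mono order_less_imp_le order_trans)
      then have S2: "norm S \<le> 2 * K"
        using norm_inverse_le_near[OF R[OF \<mu>] S] R\<mu> unfolding d by linarith
      have "norm (R \<mu> - S) \<le> norm (R \<mu>) * norm ((1 - \<mu> *\<^sub>C ((1 - s) *\<^sub>R h)) - (1 - \<mu> *\<^sub>C h)) * norm S"
        unfolding inverses_diff[OF R[OF \<mu>] S]
        by (meson mult_right_mono norm_ge_zero norm_mult_ineq order_trans)
      also have "\<dots> = norm (R \<mu>) * s * norm S" by (simp only: d)
      also have "\<dots> \<le> K * s * (2 * K)"
        using R\<mu> S2 s K(1) by (intro mult_mono) auto
      also have "\<dots> \<le> e" using sK(2) by (simp add: mult_ac)
      finally show "\<exists>R S. inverses (1 - \<mu> *\<^sub>C h) R \<and> inverses (1 - \<mu> *\<^sub>C ((1 - s) *\<^sub>R h)) S \<and> norm (R - S) \<le> e"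
        using R[OF \<mu>] S by blast
    qed
  qed
qed

text \<open>Look at the point 1 of the circle. A small \<open>k\<close> puts \<open>S\<close>, and
  hence \<open>R\<close>, close to 1, whereas \<open>(R - 1) * (1 - c) = c\<close> together with
  \<open>norm (1 - c) <= 2\<close> forces \<open>norm (R - 1) >= 1/2\<close>.\<close>

lemma not_resolvents_near_small:
  fixes c :: "'a::unital_cstar_algebra"
  assumes "norm c = 1" "norm k \<le> 1/8"
  shows "\<not> resolvents_near (1/4) c k"
proof
  assume "resolvents_near (1/4) c k"
  then obtain R S where R: "inverses (1 - c) R" and S: "inverses (1 - k) S" and RS: "norm (R - S) \<le> 1/4"
    unfolding resolvents_near_def by (metis norm_one scaleC_one)
  have one: "inverses (1::'a) 1" by (simp add: inverses_def)
  have n1: "norm (1::'a) \<le> 1" by (rule norm_one_le)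
  have "1 - S = 1 * (1 - k - 1) * S" by (rule inverses_diff[OF one S])
  then have "norm (1 - S) \<le> norm k * norm S"
    using norm_mult_ineq[of k S] by (simp add: norm_minus_commute)
  also have "\<dots> \<le> 1/8 * norm S"
    using assms(2) by (intro mult_right_mono) auto
  finally have "norm (1 - S) \<le> 1/8 * norm S" .
  moreover have "norm S \<le> norm (1 - S) + norm (1::'a)"
    by (metis norm_triangle_sub norm_minus_commute add.commute)
  \<comment> \<open>With \<open>q = norm (1 - S)\<close> the bounds read
    \<open>q <= (q + 1)/8\<close>. The constants fit because \<open>1/7 + 1/4 < 1/2\<close>.\<close>
  ultimately have "norm (1 - S) \<le> 1/7" using n1 by linarith
  with RS have R1: "norm (R - 1) < 1/2"
    using norm_triangle_ineq[of "R - S" "S - 1"] by (simp add: norm_minus_commute)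
  have "R - 1 = R * (1 - (1 - c)) * 1" by (rule inverses_diff[OF R one])
  then have "(R - 1) * (1 - c) = R * c * (1 - c)" by simp
  also have "\<dots> = R * (1 - c) * c" by (simp add: algebra_simps)
  also have "\<dots> = c" using R by (simp add: inverses_def)
  finally have "norm c \<le> norm (R - 1) * norm (1 - c)"
    using norm_mult_ineq[of "R - 1" "1 - c"] by simp
  also have "\<dots> \<le> norm (R - 1) * 2"
    using norm_triangle_ineq4[of 1 c] n1 assms(1) by (intro mult_left_mono) auto
  finally show False using R1 assms(1) by simp
qed

text \<open>This is the power of \<open>h\<close> with exponent \<open>2^n\<close>, in a form where
  each induction step is a single squaring.\<close>

primrec iterated_square :: "'a::times \<Rightarrow> nat \<Rightarrow> 'a" where
  "iterated_square h 0 = h"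
| "iterated_square h (Suc n) = iterated_square h n * iterated_square h n"

lemma norm_iterated_square_le:
  fixes k :: "'a::real_normed_algebra"
  shows "norm (iterated_square k n) \<le> norm k ^ (2 ^ n)"
proof (induction n)
  case (Suc n)
  have "norm (iterated_square k (Suc n)) \<le> norm (iterated_square k n) * norm (iterated_square k n)"
    by (simp add: norm_mult_ineq)
  also have "\<dots> \<le> norm k ^ (2 ^ n) * norm k ^ (2 ^ n)"
    by (intro mult_mono Suc) auto
  finally show ?case by (simp add: mult_2 power_add)
qed simp

text \<open>For hermitian elements the C*-identity makes the norm exactly multiplicative under
  squaring, and squares stay hermitian.\<close>

lemma norm_iterated_square_hermitian:
  fixes h :: "'a::unital_cstar_algebra"
  assumes "hermitian h" "norm h = 1"
  shows "hermitian (iterated_square h n) \<and> norm (iterated_square h n) = 1"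
  using assms
  by (induction n) (auto simp: norm_hermitian_square, auto simp: hermitian_def cstar_mult)

lemma unit_hermitian_not_all_invertible:
  fixes h :: "'a::unital_cstar_algebra"
  assumes h: "hermitian h" "norm h = 1"
  obtains \<mu> where "cmod \<mu> = 1" "\<nexists>b. inverses (1 - \<mu> *\<^sub>C h) b"
proof (rule ccontr)
  assume "\<not> thesis"
  with that have "\<And>\<mu>. cmod \<mu> = 1 \<Longrightarrow> \<exists>b. inverses (1 - \<mu> *\<^sub>C h) b" by blast
  then obtain t where t: "0 < t" "t < 1" and near: "resolvents_near (1/4) h (t *\<^sub>R h)"
    using resolvents_near_shrink[of h "1/4"] h(2) by auto
  have near_n: "resolvents_near (1/4) (iterated_square h n) (iterated_square (t *\<^sub>R h) n)" for n
    by (induction n) (auto simp: near resolvents_near_square)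
  obtain n where n: "t ^ n < 1/8"
    using real_arch_pow_inv[of "1/8" t] t by auto
  have "norm (iterated_square (t *\<^sub>R h) n) \<le> t ^ (2 ^ n)"
    using norm_iterated_square_le[of "t *\<^sub>R h" n] t h(2) by simp
  also have "\<dots> \<le> t ^ n"
    using t by (intro power_decreasing) (auto simp: less_imp_le)
  finally have "norm (iterated_square (t *\<^sub>R h) n) \<le> 1/8" using n by linarith
  then show False
    using not_resolvents_near_small near_n norm_iterated_square_hermitian[OF h] by blast
qed

text \<open>Non-invertibility of \<open>1 - \<mu> h / norm h\<close> means that
  \<open>norm h / \<mu>\<close> is a spectral value. Only its modulus is determined here; for
  positive elements that fixes the value as well.\<close>

lemma hermitian_norm_in_spectrum:
  fixes h :: "'a::unital_cstar_algebra"
  assumes "hermitian h" "h \<noteq> 0"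
  obtains z where "z \<in> spectrum h" "cmod z = norm h"
proof -
  define r where "r = complex_of_real (norm h)"
  have r: "r \<noteq> 0" using assms by (simp add: r_def)
  have "hermitian (inverse r *\<^sub>C h)" "norm (inverse r *\<^sub>C h) = 1"
    using assms r by (simp_all add: hermitian_def cstar_scaleC norm_scaleC norm_inverse r_def)
  then obtain \<mu> where \<mu>: "cmod \<mu> = 1" "\<nexists>b. inverses (1 - \<mu> *\<^sub>C (inverse r *\<^sub>C h)) b"
    by (rule unit_hermitian_not_all_invertible)
  have \<mu>0: "\<mu> \<noteq> 0" using \<mu>(1) by auto
  show thesis
  proof
    show "cmod (r * inverse \<mu>) = norm h"
      using \<mu>(1) by (simp add: norm_mult norm_inverse r_def)
    show "r * inverse \<mu> \<in> spectrum h"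
      unfolding spectrum_iff
    proof
      assume "\<exists>b. inverses ((r * inverse \<mu>) *\<^sub>C 1 - h) b"
      then obtain b where "inverses ((r * inverse \<mu>) *\<^sub>C 1 - h) b" ..
      from inverses_scaleC[OF this, of "\<mu> * inverse r"] \<mu>0 r
      have "inverses (1 - (\<mu> * inverse r) *\<^sub>C h) (inverse (\<mu> * inverse r) *\<^sub>C b)"
        by (simp add: scaleC_diff_right scaleC_scaleC field_simps)
      with \<mu>(2) show False by (auto simp: scaleC_scaleC)
    qed
  qed
qed

section \<open>Monotonicity of the norm\<close>

text \<open>The spectrum of \<open>z\<close> lies in \<open>[0, norm z]\<close>, so that of
  \<open>norm z - z\<close> lies there too, and it attains the norm of this hermitian
  element.\<close>

lemma norm_scaled_one_minus_positive_le:
  fixes z :: "'a::unital_cstar_algebra"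
  assumes "cstar_positive z"
  shows "norm (complex_of_real (norm z) *\<^sub>C 1 - z) \<le> norm z"
proof (cases "complex_of_real (norm z) *\<^sub>C 1 - z = 0")
  case False
  have "hermitian (complex_of_real (norm z) *\<^sub>C 1 - z)"
    using assms by (simp add: cstar_positive_def hermitian_diff hermitian_scaled_one)
  then obtain w where w: "w \<in> spectrum (complex_of_real (norm z) *\<^sub>C 1 - z)"
      and norm_w: "cmod w = norm (complex_of_real (norm z) *\<^sub>C 1 - z)"
    using False by (rule hermitian_norm_in_spectrum)
  have sp: "complex_of_real (norm z) - w \<in> spectrum z"
    by (rule spectrum_scaled_one_minus[OF w])
  with assms obtain s where s: "complex_of_real (norm z) - w = complex_of_real s" "0 \<le> s"
    by (auto simp: cstar_positive_def)
  with cmod_spectrum_le[OF sp] have "s \<le> norm z" by simp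
  moreover from s(1) have "w = complex_of_real (norm z - s)" by (simp add: algebra_simps)
  ultimately show ?thesis using s(2) norm_w[symmetric] by (simp del: of_real_diff)
qed simp

text \<open>The number \<open>norm x\<close> is a spectral value of \<open>x\<close>. Shifting by
  \<open>norm z\<close> makes \<open>norm x + norm z\<close> a spectral value of
  \<open>(x + z) + (norm z - z)\<close>, whose norm is at most
  \<open>norm (x + z) + norm z\<close>.\<close>

lemma norm_le_norm_add_positive:
  fixes x :: "'a::unital_cstar_algebra"
  assumes x: "cstar_positive x" and z: "cstar_positive z"
  shows "norm x \<le> norm (x + z)"
proof (cases "x = 0")
  case False
  have "hermitian x" using x by (simp add: cstar_positive_def)
  then obtain w where w: "w \<in> spectrum x" "cmod w = norm x"
    using False by (rule hermitian_norm_in_spectrum)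
  with x have w_eq: "w = complex_of_real (norm x)"
    by (auto simp: cstar_positive_def)
  let ?s = "complex_of_real (norm z)"
  have eq: "(w + ?s) *\<^sub>C 1 - (x + z + (?s *\<^sub>C 1 - z)) = w *\<^sub>C 1 - x"
    by (simp add: scaleC_add_left)
  have "w + ?s \<in> spectrum (x + z + (?s *\<^sub>C 1 - z))"
    using w(1) unfolding spectrum_iff eq .
  from cmod_spectrum_le[OF this]
  have "norm x + norm z \<le> norm (x + z + (?s *\<^sub>C 1 - z))"
    by (simp add: w_eq flip: of_real_add)
  also have "\<dots> \<le> norm (x + z) + norm z"
    using norm_triangle_ineq[of "x + z" "?s *\<^sub>C 1 - z"] norm_scaled_one_minus_positive_le[OF z]
    by linarith
  finally show ?thesis by simp
qed simp

lemma norm_mono_cstar_le: "cstar_positive x \<Longrightarrow> x \<preceq> y \<Longrightarrow> norm x \<le> norm y"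
  using norm_le_norm_add_positive[of x "y - x"] by (simp add: cstar_le_def)

section \<open>Coupled points\<close>

lemma (in cstar_metric_space) norm_triangle:
  assumes "x \<in> X" "y \<in> X" "z \<in> X"
  shows "norm (d x y) \<le> norm (d x z) + norm (d z y)"
  using norm_mono_cstar_le[OF positive triangle] assms norm_triangle_ineq order_trans by blast


text \<open>The guard is forced by \<^locale>\<open>Metric_space\<close>, which requires symmetry outside the carrier as well.\<close>

definition sum_dist ::
    "('x \<Rightarrow> 'x \<Rightarrow> 'a::real_normed_vector) \<Rightarrow> 'x set \<Rightarrow> 'x \<times> 'x \<Rightarrow> 'x \<times> 'x \<Rightarrow> real"
  where "sum_dist d S p q =
    (if p \<in> S \<times> S \<and> q \<in> S \<times> S then norm (d (fst p) (fst q)) + norm (d (snd p) (snd q)) else 0)"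

context cstar_metric_space
begin

lemma Metric_space_sum_dist:
  assumes S: "S \<subseteq> X"
  shows "Metric_space (S \<times> S) (sum_dist d S)"
proof
  show "0 \<le> sum_dist d S p q" for p q
    by (simp add: sum_dist_def)
  show "sum_dist d S p q = sum_dist d S q p" for p q
    using S commute by (auto simp: sum_dist_def subset_iff)
  show "sum_dist d S p q = 0 \<longleftrightarrow> p = q" if "p \<in> S \<times> S" "q \<in> S \<times> S" for p q
  proof -
    have "fst p \<in> X" "fst q \<in> X" "snd p \<in> X" "snd q \<in> X"
      using that S by auto
    then show ?thesis
      using that by (simp add: sum_dist_def add_nonneg_eq_0_iff zero_iff prod_eq_iff)
  qed
  show "sum_dist d S p r \<le> sum_dist d S p q + sum_dist d S q r"
    if "p \<in> S \<times> S" "q \<in> S \<times> S" "r \<in> S \<times> S" for p q r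
  proof -
    have "fst p \<in> X" "fst q \<in> X" "fst r \<in> X" "snd p \<in> X" "snd q \<in> X" "snd r \<in> X"
      using that S by auto
    then show ?thesis
      using that norm_triangle[of "fst p" "fst r" "fst q"] norm_triangle[of "snd p" "snd r" "snd q"]
      by (simp add: sum_dist_def)
  qed
qed

text \<open>Each coordinate distance is at most the sum distance, so the coordinates of a Cauchy
  sequence are Cauchy and converge separately.\<close>

lemma mcomplete_sum_dist:
  assumes S: "S \<subseteq> X" and compl: "cstar_complete d S"
  shows "Metric_space.mcomplete (S \<times> S) (sum_dist d S)"
proof -
  interpret M: Metric_space "S \<times> S" "sum_dist d S"
    by (rule Metric_space_sum_dist[OF S])
  \<comment> \<open>\<open>h\<close> stands for either projection, so one argument handles both
    coordinates.\<close>
  have conv: "\<exists>l\<in>S. cstar_converges_to d (\<lambda>n. h (s n)) l"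
    if s: "M.MCauchy s" and h: "h = fst \<or> h = snd" for s h
  proof -
    have rng: "s n \<in> S \<times> S" for n
      using s by (auto simp: M.MCauchy_def)
    have le: "norm (d (h (s m)) (h (s n))) \<le> sum_dist d S (s m) (s n)" for m n
      using h rng by (auto simp: sum_dist_def)
    have "cstar_Cauchy d (\<lambda>n. h (s n))"
      unfolding cstar_Cauchy_def uniform_limit_iff
    proof (intro allI impI)
      fix e :: real
      assume "e > 0"
      then obtain N where N: "\<And>n n'. N \<le> n \<Longrightarrow> N \<le> n' \<Longrightarrow> sum_dist d S (s n) (s n') < e"
        using s unfolding M.MCauchy_def by blast
      show "\<forall>\<^sub>F n in sequentially. \<forall>p\<in>UNIV. dist (norm (d (h (s (n + p))) (h (s n)))) 0 < e"
        unfolding eventually_sequentially by (auto intro!: exI[of _ N] le_less_trans[OF le N])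
    qed
    moreover have "range (\<lambda>n. h (s n)) \<subseteq> S"
      using h rng by (auto simp: mem_Times_iff)
    ultimately show ?thesis
      using compl unfolding cstar_complete_def by blast
  qed
  show ?thesis
    unfolding M.mcomplete_def
  proof (intro allI impI)
    fix s
    assume s: "M.MCauchy s"
    then have rng: "s n \<in> S \<times> S" for n
      by (auto simp: M.MCauchy_def)
    obtain l where l: "l \<in> S" "(\<lambda>n. norm (d (fst (s n)) l)) \<longlonglongrightarrow> 0"
      using conv[OF s, of fst] by (auto simp: cstar_converges_to_def)
    obtain m where m: "m \<in> S" "(\<lambda>n. norm (d (snd (s n)) m)) \<longlonglongrightarrow> 0"
      using conv[OF s, of snd] by (auto simp: cstar_converges_to_def)
    have "(\<lambda>n. sum_dist d S (s n) (l, m)) \<longlonglongrightarrow> 0"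
      using tendsto_add[OF l(2) m(2)] rng l(1) m(1) by (simp add: sum_dist_def)
    then have "limitin M.mtopology s (l, m) sequentially"
      using rng l(1) m(1) by (simp add: M.limitin_metric tendsto_iff)
    then show "\<exists>p. limitin M.mtopology s p sequentially" ..
  qed
qed

end

theorem theorem2p1:
  fixes X :: "'x set"
    and d :: "'x \<Rightarrow> 'x \<Rightarrow> 'a::unital_cstar_algebra"
    and F :: "'x \<times> 'x \<Rightarrow> 'x"
    and g :: "'x \<Rightarrow> 'x"
    and a :: 'a
  assumes "cstar_metric_space X d"
    and "cstar_complete d X"
    and "F \<in> X \<times> X \<rightarrow> X"
    and "g \<in> X \<rightarrow> X"
    and "\<And>x y u v. \<lbrakk>x \<in> X; y \<in> X; u \<in> X; v \<in> X\<rbrakk> \<Longrightarrow>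
      d (F (x, y)) (F (u, v)) \<preceq>
        cstar a * d (g x) (g u) * a + cstar a * d (g y) (g v) * a"
    and "norm a < 1 / sqrt 2"
    and "F ` (X \<times> X) \<subseteq> g ` X"
    and "cstar_complete d (g ` X)"
  shows "(\<exists>p. coupled_coincidence_point X F g p) \<and>
    (w_compatible X F g \<longrightarrow> (\<exists>!p. common_coupled_fixed_point X F g p))"
proof -
  interpret cstar_metric_space X d by fact
  note F = assms(3) and g = assms(4)
  define k where "k = 2 * (norm a)\<^sup>2"
  have "(norm a)\<^sup>2 < (1 / sqrt 2)\<^sup>2"
    using assms(6) by (intro power_strict_mono) auto
  then have k1: "k < 1" by (simp add: k_def power_divide)
  have norm_conj: "norm (cstar a * w * a) \<le> (norm a)\<^sup>2 * norm w" for w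
  proof -
    have "norm (cstar a * w * a) \<le> norm (cstar a) * norm w * norm a"
      by (meson mult_right_mono norm_ge_zero norm_mult_ineq order_trans)
    then show ?thesis by (simp add: power2_eq_square mult_ac)
  qed
  have contr: "norm (d (F (x, y)) (F (u, v))) \<le> (norm a)\<^sup>2 * (norm (d (g x) (g u)) + norm (d (g y) (g v)))"
    if "x \<in> X" "y \<in> X" "u \<in> X" "v \<in> X" for x y u v
  proof -
    have "F (x, y) \<in> X" "F (u, v) \<in> X" using that F by auto
    then have "norm (d (F (x, y)) (F (u, v)))
        \<le> norm (cstar a * d (g x) (g u) * a + cstar a * d (g y) (g v) * a)"
      by (intro norm_mono_cstar_le positive assms(5) that)
    also have "\<dots> \<le> norm (cstar a * d (g x) (g u) * a) + norm (cstar a * d (g y) (g v) * a)"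
      by (rule norm_triangle_ineq)
    also have "\<dots> \<le> (norm a)\<^sup>2 * norm (d (g x) (g u)) + (norm a)\<^sup>2 * norm (d (g y) (g v))"
      by (intro add_mono norm_conj)
    finally show ?thesis by (simp add: distrib_left)
  qed
  \<comment> \<open>Adding \<open>contr\<close> for the swapped pairs closes the estimate on the sum
    of both distances; this is where the factor 2 in \<open>k\<close> comes from.\<close>
  have contr2: "norm (d (F (x, y)) (F (u, v))) + norm (d (F (y, x)) (F (v, u)))
      \<le> k * (norm (d (g x) (g u)) + norm (d (g y) (g v)))"
    if "x \<in> X" "y \<in> X" "u \<in> X" "v \<in> X" for x y u v
    using contr[OF that] contr[OF that(2,1,4,3)] by (simp add: k_def algebra_simps)

  define S where "S = g ` X"
  have S: "S \<subseteq> X" using g by (auto simp: S_def)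
  interpret M: Metric_space "S \<times> S" "sum_dist d S"
    by (rule Metric_space_sum_dist[OF S])
  \<comment> \<open>\<open>G\<close> picks preimages under \<open>g\<close>, so that
    \<open>T\<close> acts on pairs of values of \<open>g\<close>, the quantities in which
    \<open>contr2\<close> is a contraction. A fixed point of \<open>T\<close> then lifts to a
    coincidence point.\<close>
  define G where "G = inv_into X g"
  have G: "G u \<in> X" "g (G u) = u" if "u \<in> S" for u
    using that by (simp_all add: G_def S_def inv_into_into f_inv_into_f)
  define T where "T = (\<lambda>(u, v). (F (G u, G v), F (G v, G u)))"
  have T: "T \<in> S \<times> S \<rightarrow> S \<times> S"
    using assms(7) G(1) by (auto simp: T_def S_def)
  have "sum_dist d S (T p) (T q) \<le> k * sum_dist d S p q" if p: "p \<in> S \<times> S" and q: "q \<in> S \<times> S" for p q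
  proof -
    have "T p \<in> S \<times> S" "T q \<in> S \<times> S" using T p q by blast+
    with p q show ?thesis
      using contr2[of "G (fst p)" "G (snd p)" "G (fst q)" "G (snd q)"] G
      by (auto simp: sum_dist_def T_def)
  qed
  moreover have "M.mcomplete"
    using mcomplete_sum_dist[OF S] assms(8) by (simp add: S_def)
  moreover have "S \<times> S \<noteq> {}" using nonempty by (simp add: S_def)
  ultimately obtain p where "p \<in> S \<times> S" "T p = p"
    using M.Banach_fixedpoint_thm[OF _ _ T k1] by blast
  then obtain u v where "u \<in> S" "v \<in> S" "F (G u, G v) = u" "F (G v, G u) = v"
    by (auto simp: T_def)
  then have coinc: "coupled_coincidence_point X F g (G u, G v)"
    by (simp add: coupled_coincidence_point_def G)

  \<comment> \<open>At coincidence points the values of \<open>F\<close> are those of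
    \<open>g\<close>, so \<open>contr2\<close> bounds a distance by \<open>k < 1\<close> times
    itself.\<close>
  have coinc_unique: "g x = g x' \<and> g y = g y'"
    if "coupled_coincidence_point X F g (x, y)" "coupled_coincidence_point X F g (x', y')" for x y x' y'
  proof -
    have X: "x \<in> X" "y \<in> X" "x' \<in> X" "y' \<in> X"
      and eq: "F (x, y) = g x" "F (y, x) = g y" "F (x', y') = g x'" "F (y', x') = g y'"
      using that by (auto simp: coupled_coincidence_point_def)
    let ?D = "norm (d (g x) (g x')) + norm (d (g y) (g y'))"
    have "?D \<le> k * ?D" using contr2[OF X] by (simp add: eq)
    then have "(1 - k) * ?D \<le> 0" by (simp add: algebra_simps)
    then have "?D \<le> 0" using k1 by (simp add: mult_le_0_iff)
    then have "d (g x) (g x') = 0" "d (g y) (g y') = 0"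
      by (smt (verit) norm_ge_zero norm_le_zero_iff)+
    moreover have "g x \<in> X" "g x' \<in> X" "g y \<in> X" "g y' \<in> X" using X g by auto
    ultimately show ?thesis by (simp add: zero_iff)
  qed

  have "\<exists>!p. common_coupled_fixed_point X F g p" if w: "w_compatible X F g"
  proof -
    obtain x y where xy: "x \<in> X" "y \<in> X" "F (x, y) = g x" "F (y, x) = g y"
      using coinc by (auto simp: coupled_coincidence_point_def)
    have X: "g x \<in> X" "g y \<in> X" using xy g by auto
    have "g (F (x, y)) = F (g x, g y)" "g (F (y, x)) = F (g y, g x)"
      using w xy unfolding w_compatible_def by metis+
    then have F2: "F (g x, g y) = g (g x)" "F (g y, g x) = g (g y)"
      by (simp_all add: xy)
    \<comment> \<open>\<open>F2\<close> makes \<open>(g x, g y)\<close> another coincidence point,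
      so \<open>g\<close> takes the same values there as at \<open>(x, y)\<close>.\<close>
    then have "g (g x) = g x \<and> g (g y) = g y"
      using xy X by (intro coinc_unique) (simp_all add: coupled_coincidence_point_def)
    with F2 X have "common_coupled_fixed_point X F g (g x, g y)"
      by (simp add: common_coupled_fixed_point_def)
    \<comment> \<open>Common coupled fixed points are coincidence points fixed by \<open>g\<close>,
      so equal values of \<open>g\<close> mean equal points.\<close>
    moreover have "p = q" if "common_coupled_fixed_point X F g p" "common_coupled_fixed_point X F g q" for p q
      using that coinc_unique[of "fst p" "snd p" "fst q" "snd q"]
      by (auto simp: common_coupled_fixed_point_def coupled_coincidence_point_def split: prod.splits)
    ultimately show ?thesis by blast
  qed
  with coinc show ?thesis by blast
qed

end
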